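(* Let $n\ge 3$, let $M\ge 1$ and $\bar M=\log M$, let $A\in{\cal P}_n\cap[1/M,M]^{n\times n}$, and put $\bar a_{ij}=\log a_{ij}$. Let $\alpha_n\ge 0$ denote the acceptance threshold of inconsistency and let $\alpha_n^*=n+RI_n(n-1)\alpha_n$. Consider the mixed 0-1 optimization problem in the real variables $x_{ij}$ ($1\le i,j\le n$), $z_i$ ($1\le i\le n$) and the binary variables $y_{ij}$ ($1\le i<j\le n$): $$\begin{array}{rll} \min & \sum_{i=1}^{n-1}\sum_{j=i+1}^{n} y_{ij} & \\ \mathrm{s.t.} & \sum_{j=1}^{n} e^{x_{ij}+z_j-z_i}\le \alpha_n^*, & i=1,\dots,n,\\ & x_{ij}=-x_{ji}, & 1\le i\le j\le n,\\ & -\bar M\le x_{ij}\le \bar M, & 1\le i<j\le n,\\ & -2\bar M y_{ij}\le x_{ij}-\bar a_{ij}\le 2\bar M y_{ij}, & 1\le i<j\le n,\\ & y_{ij}\in\{0,1\}, & 1\le i<j\le n. \end{array}$$ Then the optimum value of this problem equals the minimal number of elements above the main diagonal of $A$ that have to be modified (together with their reciprocals) in order to achieve $CR_n\le\alpha_n$, i.e. it equals $$\min\{\,d(A,\hat A)\ :\ \hat A\in{\cal P}_n\cap[1/M,M]^{n\times n},\ CR_n(\hat A)\le\alpha_n\,\}.$$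
   Context: ${\cal P}_n$ is the set of $n\times n$ pairwise comparison matrices: real matrices $A=(a_{ij})$ with $a_{ij}>0$ and $a_{ij}=1/a_{ji}$ for all $i,j$ (so $a_{ii}=1$). $[1/M,M]^{n\times n}$ is the set of $n\times n$ matrices all of whose entries lie in $[1/M,M]$. For $A,\hat A\in{\cal P}_n$, $d(A,\hat A)=|\{(i,j):1\le i<j\le n,\ a_{ij}\ne\hat a_{ij}\}|$. For $A\in{\cal P}_n$, $\lambda_{\max}(A)$ is the largest (Perron) eigenvalue of $A$. $RI_n>0$ is a fixed positive real constant depending only on $n$ (in Saaty's definition, $RI_n=(\overline{\lambda_{\max}}-n)/(n-1)$ where $\overline{\lambda_{\max}}$ is the average largest eigenvalue of randomly generated $n\times n$ pairwise comparison matrices). Saaty's inconsistency index is $CR_n(A)=\dfrac{(\lambda_{\max}(A)-n)/(n-1)}{RI_n}$. *)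

theory Defs
  imports Complex_Main "Jordan_Normal_Form.Char_Poly"
begin

text \<open>Matrices are those of Jordan_Normal_Form, so rows and columns are indexed by
  \<open>0, \<dots>, n - 1\<close>.\<close>

definition pairwise_comparison_mats :: "nat \<Rightarrow> real mat set" where
  "pairwise_comparison_mats n =
     {A \<in> carrier_mat n n. \<forall>i<n. \<forall>j<n. A $$ (i, j) > 0 \<and> A $$ (i, j) = 1 / A $$ (j, i)}"

definition bounded_mats :: "nat \<Rightarrow> real \<Rightarrow> real mat set" where
  "bounded_mats n M = {A \<in> carrier_mat n n. \<forall>i<n. \<forall>j<n. A $$ (i, j) \<in> {1 / M..M}}"

definition upper_dist :: "nat \<Rightarrow> real mat \<Rightarrow> real mat \<Rightarrow> nat" where
  "upper_dist n A B = card {(i, j). i < j \<and> j < n \<and> A $$ (i, j) \<noteq> B $$ (i, j)}"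

text \<open>The maximum ranges over the real eigenvalues. For a matrix with positive entries this
  set is finite and nonempty, and its maximum is the Perron eigenvalue.\<close>

definition lambda_max :: "real mat \<Rightarrow> real" where
  "lambda_max A = Max {k. eigenvalue A k}"

text \<open>The random index \<open>RI\<close> is an arbitrary function of the dimension.\<close>

definition CR :: "(nat \<Rightarrow> real) \<Rightarrow> nat \<Rightarrow> real mat \<Rightarrow> real" where
  "CR RI n A = ((lambda_max A - real n) / (real n - 1)) / RI n"

definition alpha_star :: "(nat \<Rightarrow> real) \<Rightarrow> nat \<Rightarrow> real \<Rightarrow> real" where
  "alpha_star RI n \<alpha> = real n + RI n * (real n - 1) * \<alpha>"

text \<open>The variables are functions on the natural numbers. Only \<open>x i j\<close> and \<open>z i\<close> with
  \<open>i, j < n\<close> and \<open>y i j\<close> with \<open>i < j < n\<close> occur in the constraints and the objective;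
  all other values are irrelevant.\<close>

definition feasible ::
  "nat \<Rightarrow> real \<Rightarrow> real mat \<Rightarrow> real \<Rightarrow>
   (nat \<Rightarrow> nat \<Rightarrow> real) \<times> (nat \<Rightarrow> real) \<times> (nat \<Rightarrow> nat \<Rightarrow> real) \<Rightarrow> bool" where
  "feasible n M A a = (\<lambda>(x, z, y).
     (\<forall>i<n. (\<Sum>j<n. exp (x i j + z j - z i)) \<le> a) \<and>
     (\<forall>j<n. \<forall>i\<le>j. x i j = - x j i) \<and>
     (\<forall>j<n. \<forall>i<j. - ln M \<le> x i j \<and> x i j \<le> ln M) \<and>
     (\<forall>j<n. \<forall>i<j. - 2 * ln M * y i j \<le> x i j - ln (A $$ (i, j)) \<and>
                   x i j - ln (A $$ (i, j)) \<le> 2 * ln M * y i j) \<and>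
     (\<forall>j<n. \<forall>i<j. y i j \<in> {0, 1}))"

definition objective ::
  "nat \<Rightarrow> (nat \<Rightarrow> nat \<Rightarrow> real) \<times> (nat \<Rightarrow> real) \<times> (nat \<Rightarrow> nat \<Rightarrow> real) \<Rightarrow> real" where
  "objective n = (\<lambda>(x, z, y). \<Sum>i<n. \<Sum>j\<in>{i<..<n}. y i j)"

definition acceptable ::
  "(nat \<Rightarrow> real) \<Rightarrow> nat \<Rightarrow> real \<Rightarrow> real \<Rightarrow> real mat \<Rightarrow> bool" where
  "acceptable RI n M \<alpha> B \<longleftrightarrow>
     B \<in> pairwise_comparison_mats n \<inter> bounded_mats n M \<and> CR RI n B \<le> \<alpha>"

end

theory Submission
  imports Defs "HOL-Analysis.Function_Topology"
begin

text \<open>The constraint \<open>\<Sum>\<^sub>j exp (x\<^sub>i\<^sub>j + z\<^sub>j - z\<^sub>i) \<le> a\<close> is the inequality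
  \<open>B w \<le> a w\<close> for the positive matrix \<open>B = exp x\<close> and the positive vector \<open>w = exp z\<close>.
  The theorem rests on the Collatz--Wielandt characterisation of the Perron eigenvalue
  (\<open>lambda_max_le_iff\<close>): such a \<open>w\<close> exists exactly when \<open>lambda_max B \<le> a\<close>, and for
  \<open>a = alpha_star RI n \<alpha>\<close> this is the same as \<open>CR RI n B \<le> \<alpha>\<close>.

  One half of the characterisation compares an eigenvector with \<open>w\<close> at the index where their
  quotient is largest in absolute value. The other half needs a positive eigenvector. It is
  obtained in \<open>positive_eigenvector_exists\<close> by minimising \<open>max\<^sub>i (B x)\<^sub>i / x\<^sub>i\<close>: the minimum
  is attained because replacing \<open>x\<close> by the normalised \<open>B x\<close> never increases the quotient and
  moves \<open>x\<close> into a compact box, and a minimiser is an eigenvector because otherwise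
  \<open>B x\<close> would have a strictly smaller quotient.

  Taking logarithms now translates acceptable matrices into feasible points and back. The
  big-M constraint forces \<open>y\<^sub>i\<^sub>j = 1\<close> wherever the entry is modified, and with \<open>y\<^sub>i\<^sub>j = 1\<close> it
  says nothing new, since both logarithms lie in \<open>[- ln M, ln M]\<close>. Thus every acceptable matrix
  gives a feasible point whose objective is its distance to \<open>A\<close>
  (\<open>acceptable_imp_feasible\<close>), and every feasible point gives an acceptable matrix whose distance
  is at most the objective (\<open>feasible_imp_acceptable\<close>). A closest acceptable matrix exists because
  distances are natural numbers and the matrix of ones is acceptable.\<close>

section \<open>Positive eigenvectors of positive matrices\<close>

lemma continuous_on_Max_image:
  fixes f :: "'i \<Rightarrow> 'a::topological_space \<Rightarrow> 'b::linorder_topology"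
  assumes "finite I" "I \<noteq> {}" "\<And>i. i \<in> I \<Longrightarrow> continuous_on S (f i)"
  shows "continuous_on S (\<lambda>x. Max ((\<lambda>i. f i x) ` I))"
  using assms
proof (induction rule: finite_ne_induct)
  case (singleton i)
  then show ?case by simp
next
  case (insert i I)
  then show ?case by (simp add: continuous_on_max)
qed

text \<open>By Tychonoff's theorem the box is compact for the product topology, although it has
  infinitely many coordinates.\<close>

lemma compact_function_box:
  fixes c d :: real
  shows "compact (PiE (UNIV :: 'i set) (\<lambda>_. {c..d}))"
proof -
  have "compactin (product_topology (\<lambda>_. euclidean) (UNIV :: 'i set)) (PiE UNIV (\<lambda>_. {c..d}))"
    by (simp add: compactin_PiE)
  then show ?thesis by (simp add: euclidean_product_topology)
qed

text \<open>The existence part of Perron's theorem. Write \<open>F x\<close> for the largest quotient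
  \<open>(B x)\<^sub>i / x\<^sub>i\<close> and let \<open>x\<close> minimise \<open>F\<close> over the positive vectors. The vector
  \<open>F x \<cdot> x - B x\<close> is nonnegative. If it were nonzero, then \<open>B\<close>, having positive entries,
  would send it to a positive vector; that says \<open>B (B x) < F x \<cdot> B x\<close> in every row, hence
  \<open>F (B x) < F x\<close>. So \<open>x\<close> is an eigenvector.\<close>

theorem positive_eigenvector_exists:
  fixes b :: "nat \<Rightarrow> nat \<Rightarrow> real"
  assumes "n > 0" and pos: "\<And>i j. i < n \<Longrightarrow> j < n \<Longrightarrow> b i j > 0"
  obtains r w where "\<And>i. i < n \<Longrightarrow> w i > 0"
    and "\<And>i. i < n \<Longrightarrow> (\<Sum>j<n. b i j * w j) = r * w i"
proof -
  define T where "T = (\<lambda>x i. \<Sum>j<n. b i j * x j)"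
  define F where "F = (\<lambda>x. Max ((\<lambda>i. T x i / x i) ` {..<n}))"
  define E where "E = (\<lambda>(i, j). b i j) ` ({..<n} \<times> {..<n})"
  define c where "c = Min E"
  define d where "d = Max E"
  have finE: "finite E" and neE: "E \<noteq> {}"
    using \<open>n > 0\<close> by (auto simp: E_def)
  have b_in: "c \<le> b i j" "b i j \<le> d" if "i < n" "j < n" for i j
    using that finE by (auto simp: c_def d_def E_def intro!: Min_le Max_ge)
  have c_pos: "c > 0"
    using Min_in[OF finE neE] pos by (auto simp: c_def E_def)
  have cd: "c \<le> d"
    using b_in[OF \<open>n > 0\<close> \<open>n > 0\<close>] by simp
  define C where "C = PiE (UNIV :: nat set) (\<lambda>_. {c..d})"
  have inC: "x \<in> C \<longleftrightarrow> (\<forall>i. c \<le> x i \<and> x i \<le> d)" for x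
    by (auto simp: C_def)
  have ne: "{..<n} \<noteq> {}" using \<open>n > 0\<close> by auto
  have T_eq: "T x i = (\<Sum>j<n. b i j * x j)" for x i by (simp add: T_def)
  have T_pos: "T x i > 0" if "i < n" "\<And>i. i < n \<Longrightarrow> x i > 0" for x i
    unfolding T_def using that pos ne by (intro sum_pos) auto
  have T_mono: "T x i \<le> T y i" if "i < n" "\<And>i. i < n \<Longrightarrow> x i \<le> y i" for x y i
    unfolding T_def using that pos by (intro sum_mono mult_left_mono) (auto simp: less_imp_le)
  have T_scale: "T (\<lambda>i. t * x i) i = t * T x i" for t x i
    by (simp add: T_def sum_distrib_left mult_ac)
  have F_ge: "T x i \<le> F x * x i" if "i < n" "x i > 0" for x i
  proof -
    have "T x i / x i \<le> F x" unfolding F_def using that(1) by (intro Max_ge) auto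
    then show ?thesis using that(2) by (simp add: pos_divide_le_eq)
  qed
  have F_le: "F x \<le> t"
    if "\<And>i. i < n \<Longrightarrow> x i > 0" "\<And>i. i < n \<Longrightarrow> T x i \<le> t * x i" for x t
    unfolding F_def using that ne by (auto simp: pos_divide_le_eq)
  have F_less: "F x < t"
    if "\<And>i. i < n \<Longrightarrow> x i > 0" "\<And>i. i < n \<Longrightarrow> T x i < t * x i" for x t
    unfolding F_def using that ne by (auto simp: pos_divide_less_eq)
  have "continuous_on C F"
    unfolding F_def
  proof (rule continuous_on_Max_image)
    fix i
    have coord: "continuous_on C (\<lambda>x. x k)" for k
      by (rule continuous_on_subset[OF continuous_on_product_coordinates]) simp
    have "x i \<noteq> 0" if "x \<in> C" for x
      using that c_pos unfolding inC by (metis less_le_not_le)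
    then show "continuous_on C (\<lambda>x. T x i / x i)"
      unfolding T_def by (intro continuous_intros coord) auto
  qed (use ne in auto)
  moreover have "compact C" unfolding C_def by (rule compact_function_box)
  moreover have "C \<noteq> {}" using cd by (auto simp: C_def PiE_eq_empty_iff)
  ultimately obtain x where x: "x \<in> C" and x_min: "\<And>y. y \<in> C \<Longrightarrow> F x \<le> F y"
    using continuous_attains_inf[of C F] by auto
  have x_pos: "x i > 0" for i
    using x c_pos unfolding inC by (meson less_le_trans)
  \<comment> \<open>Minimality extends from the box to all positive vectors: the entries of \<open>T y\<close>, divided
    by the sum of those of \<open>y\<close>, are averages of entries of \<open>b\<close>.\<close>
  have global: "F x \<le> F y" if y: "\<And>i. i < n \<Longrightarrow> y i > 0" for y
  proof -
    define s where "s = (\<Sum>j<n. y j)"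
    \<comment> \<open>Only the first \<open>n\<close> coordinates matter; the value \<open>c\<close> puts the others in the box.\<close>
    define u where "u = (\<lambda>i. if i < n then T y i / s else c)"
    have s_pos: "s > 0" unfolding s_def using y ne by (intro sum_pos) auto
    have "c * s \<le> T y i" "T y i \<le> d * s" if "i < n" for i
      unfolding s_def T_def sum_distrib_left using that b_in y
      by (intro sum_mono mult_right_mono; simp add: less_imp_le)+
    then have "u \<in> C"
      unfolding inC u_def using s_pos cd
      by (auto simp: pos_divide_le_eq pos_le_divide_eq)
    have "F u \<le> F y"
    proof (rule F_le)
      fix i assume i: "i < n"
      show "u i > 0" using i T_pos[OF i, of y] y s_pos by (simp add: u_def)
      have "T u i = T (\<lambda>i. (1 / s) * T y i) i"
        unfolding T_eq[of u] T_eq[of "\<lambda>i. (1 / s) * T y i"] by (simp add: u_def)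
      also have "\<dots> = (1 / s) * T (T y) i" by (rule T_scale)
      also have "\<dots> \<le> (1 / s) * T (\<lambda>i. F y * y i) i"
        using s_pos i F_ge y by (intro mult_left_mono T_mono) auto
      also have "\<dots> = F y * u i" using i by (simp add: T_scale u_def)
      finally show "T u i \<le> F y * u i" .
    qed
    then show ?thesis using x_min[OF \<open>u \<in> C\<close>] by simp
  qed
  have "T x i = F x * x i" if i: "i < n" for i
  proof (rule ccontr)
    assume "T x i \<noteq> F x * x i"
    then have strict: "T x i < F x * x i" using F_ge[OF i, of x] x_pos by simp
    have "F (T x) < F x"
    proof (rule F_less)
      fix k assume k: "k < n"
      show "T x k > 0" using k x_pos by (intro T_pos)
      have "T (T x) k < T (\<lambda>j. F x * x j) k"
        unfolding T_eq[of "T x"] T_eq[of "\<lambda>j. F x * x j"]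
      proof (rule sum_strict_mono_ex1)
        show "\<forall>j\<in>{..<n}. b k j * T x j \<le> b k j * (F x * x j)"
          using F_ge x_pos pos[OF k] by (auto intro!: mult_left_mono less_imp_le)
        show "\<exists>j\<in>{..<n}. b k j * T x j < b k j * (F x * x j)"
          using strict i pos[OF k i] by (intro bexI[of _ i]) auto
      qed simp
      then show "T (T x) k < F x * T x k" by (simp add: T_scale)
    qed
    moreover have "F x \<le> F (T x)" using T_pos x_pos by (intro global) auto
    ultimately show False by simp
  qed
  then show thesis using that[of x "F x"] x_pos by (simp add: T_def)
qed

section \<open>The largest eigenvalue and subinvariant vectors\<close>

lemma mult_mat_vec_index:
  assumes "B \<in> carrier_mat n n" "v \<in> carrier_vec n" "i < n"
  shows "(B *\<^sub>v v) $ i = (\<Sum>j<n. B $$ (i, j) * v $ j)"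
  using assms by (auto simp: scalar_prod_def lessThan_atLeast0 intro!: sum.cong)

lemma finite_eigenvalues:
  fixes B :: "'a::field mat"
  assumes "B \<in> carrier_mat n n"
  shows "finite {k. eigenvalue B k}"
proof -
  have "char_poly B \<noteq> 0" using degree_monic_char_poly[OF assms] by auto
  then show ?thesis
    using poly_roots_finite by (simp add: eigenvalue_root_char_poly[OF assms])
qed

text \<open>The quotients \<open>\<bar>v\<^sub>i\<bar> / w\<^sub>i\<close> of an eigenvector \<open>v\<close> are largest at some index; the row of
  \<open>B v = k v\<close> with that index bounds \<open>k\<close>.\<close>

lemma eigenvalue_le_if_subinvariant:
  fixes B :: "real mat"
  assumes B: "B \<in> carrier_mat n n"
    and nonneg: "\<And>i j. i < n \<Longrightarrow> j < n \<Longrightarrow> B $$ (i, j) \<ge> 0"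
    and w_pos: "\<And>i. i < n \<Longrightarrow> w i > 0"
    and w: "\<And>i. i < n \<Longrightarrow> (\<Sum>j<n. B $$ (i, j) * w j) \<le> a * w i"
    and "eigenvalue B k"
  shows "k \<le> a"
proof -
  obtain v where v: "v \<in> carrier_vec n" "v \<noteq> 0\<^sub>v n" "B *\<^sub>v v = k \<cdot>\<^sub>v v"
    using \<open>eigenvalue B k\<close> B by (auto simp: eigenvalue_def eigenvector_def)
  obtain m where m: "m < n" "v $ m \<noteq> 0"
    using v(1,2) by (metis carrier_vecD eq_vecI index_zero_vec)
  define q where "q = (\<lambda>i. \<bar>v $ i\<bar> / w i)"
  have "Max (q ` {..<n}) \<in> q ` {..<n}" using m by (intro Max_in) auto
  then obtain i where i: "i < n" and "Max (q ` {..<n}) = q i" by auto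
  then have q_le: "q j \<le> q i" if "j < n" for j
    using Max_ge[of "q ` {..<n}" "q j"] that by simp
  have v_le: "\<bar>v $ j\<bar> \<le> q i * w j" if "j < n" for j
    using q_le[OF that] w_pos[OF that] by (simp add: q_def pos_divide_le_eq)
  have vi: "\<bar>v $ i\<bar> = q i * w i" using w_pos[OF i] by (simp add: q_def)
  have "0 < q m" using m w_pos by (simp add: q_def)
  then have qi: "q i > 0" using q_le[OF m(1)] by simp
  have "k * \<bar>v $ i\<bar> \<le> \<bar>k * v $ i\<bar>" by (simp add: abs_mult mult_right_mono)
  also have "k * v $ i = (B *\<^sub>v v) $ i" using v i by simp
  also have "\<dots> = (\<Sum>j<n. B $$ (i, j) * v $ j)" by (rule mult_mat_vec_index[OF B v(1) i])
  also have "\<bar>\<dots>\<bar> \<le> (\<Sum>j<n. \<bar>B $$ (i, j) * v $ j\<bar>)" by (rule sum_abs)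
  also have "\<dots> \<le> (\<Sum>j<n. q i * (B $$ (i, j) * w j))"
  proof (rule sum_mono)
    fix j assume "j \<in> {..<n}"
    then have "B $$ (i, j) * \<bar>v $ j\<bar> \<le> B $$ (i, j) * (q i * w j)"
      using nonneg i v_le by (intro mult_left_mono) auto
    then show "\<bar>B $$ (i, j) * v $ j\<bar> \<le> q i * (B $$ (i, j) * w j)"
      using nonneg[OF i, of j] \<open>j \<in> {..<n}\<close> by (simp add: abs_mult mult_ac)
  qed
  also have "\<dots> \<le> q i * (a * w i)"
    unfolding sum_distrib_left[symmetric] using w[OF i] qi by (intro mult_left_mono) auto
  also have "\<dots> = a * \<bar>v $ i\<bar>" by (simp add: vi)
  finally show "k \<le> a" using vi qi w_pos[OF i] by simp
qed

text \<open>The Collatz--Wielandt characterisation of the Perron eigenvalue. A positive eigenvector is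
  itself a witness from left to right, and it shows that the set of real eigenvalues, whose maximum
  is \<open>lambda_max\<close>, is nonempty.\<close>

theorem lambda_max_le_iff:
  assumes B: "B \<in> carrier_mat n n" and "n > 0"
    and pos: "\<And>i j. i < n \<Longrightarrow> j < n \<Longrightarrow> B $$ (i, j) > 0"
  shows "lambda_max B \<le> a \<longleftrightarrow>
    (\<exists>w. (\<forall>i<n. w i > 0) \<and> (\<forall>i<n. (\<Sum>j<n. B $$ (i, j) * w j) \<le> a * w i))"
proof -
  obtain r u where u_pos: "\<And>i. i < n \<Longrightarrow> u i > 0"
    and u: "\<And>i. i < n \<Longrightarrow> (\<Sum>j<n. B $$ (i, j) * u j) = r * u i"
    using positive_eigenvector_exists[of n "\<lambda>i j. B $$ (i, j)", OF \<open>n > 0\<close> pos] by metis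
  have "B *\<^sub>v vec n u = r \<cdot>\<^sub>v vec n u"
  proof (rule eq_vecI)
    fix i assume "i < dim_vec (r \<cdot>\<^sub>v vec n u)"
    then have "i < n" by simp
    then show "(B *\<^sub>v vec n u) $ i = (r \<cdot>\<^sub>v vec n u) $ i"
      using mult_mat_vec_index[OF B, of "vec n u" i] u by simp
  qed (use B in simp)
  moreover have "vec n u \<noteq> 0\<^sub>v n"
  proof
    assume "vec n u = 0\<^sub>v n"
    then have "vec n u $ 0 = 0\<^sub>v n $ 0" by simp
    then show False using u_pos[OF \<open>n > 0\<close>] \<open>n > 0\<close> by simp
  qed
  ultimately have "eigenvector B (vec n u) r"
    using B by (simp add: eigenvector_def)
  then have r: "eigenvalue B r" unfolding eigenvalue_def by blast
  note fin = finite_eigenvalues[OF B]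
  show ?thesis
  proof
    assume "lambda_max B \<le> a"
    then have "r \<le> a" unfolding lambda_max_def using Max_ge[OF fin, of r] r by simp
    then have "\<forall>i<n. (\<Sum>j<n. B $$ (i, j) * u j) \<le> a * u i"
      using u u_pos by (auto intro!: mult_right_mono less_imp_le)
    then show "\<exists>w. (\<forall>i<n. w i > 0) \<and> (\<forall>i<n. (\<Sum>j<n. B $$ (i, j) * w j) \<le> a * w i)"
      using u_pos by blast
  next
    assume "\<exists>w. (\<forall>i<n. w i > 0) \<and> (\<forall>i<n. (\<Sum>j<n. B $$ (i, j) * w j) \<le> a * w i)"
    then obtain w where w: "\<forall>i<n. w i > 0"
      "\<forall>i<n. (\<Sum>j<n. B $$ (i, j) * w j) \<le> a * w i" by blast
    have "k \<le> a" if "eigenvalue B k" for k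
      by (rule eigenvalue_le_if_subinvariant[OF B _ _ _ that, of w a])
        (use w pos in \<open>auto intro: less_imp_le\<close>)
    then show "lambda_max B \<le> a"
      unfolding lambda_max_def using fin r by (subst Max_le_iff) auto
  qed
qed

section \<open>Feasible points and acceptable matrices\<close>

lemma pairwise_comparison_matsD:
  assumes "B \<in> pairwise_comparison_mats n"
  shows "B \<in> carrier_mat n n"
    and "i < n \<Longrightarrow> j < n \<Longrightarrow> B $$ (i, j) > 0"
    and "i < n \<Longrightarrow> j < n \<Longrightarrow> B $$ (i, j) = 1 / B $$ (j, i)"
  using assms unfolding pairwise_comparison_mats_def by blast+

lemma CR_le_iff:
  assumes "n > 1" "RI n > 0"
  shows "CR RI n B \<le> \<alpha> \<longleftrightarrow> lambda_max B \<le> alpha_star RI n \<alpha>"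
  using assms by (simp add: CR_def alpha_star_def pos_divide_le_eq algebra_simps)

text \<open>The form of the acceptability condition that matches the first constraint: the
  subinvariant vector is written as \<open>w = exp z\<close>.\<close>

lemma CR_le_iff_exp:
  assumes "n > 1" "RI n > 0" and B: "B \<in> pairwise_comparison_mats n"
  shows "CR RI n B \<le> \<alpha> \<longleftrightarrow>
    (\<exists>z. \<forall>i<n. (\<Sum>j<n. exp (ln (B $$ (i, j)) + z j - z i)) \<le> alpha_star RI n \<alpha>)"
proof -
  define a where "a = alpha_star RI n \<alpha>"
  have carrier: "B \<in> carrier_mat n n" and pos: "\<And>i j. i < n \<Longrightarrow> j < n \<Longrightarrow> B $$ (i, j) > 0"
    using pairwise_comparison_matsD(1,2)[OF B] by blast+
  have row: "(\<Sum>j<n. exp (ln (B $$ (i, j)) + z j - z i)) \<le> a \<longleftrightarrow>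
      (\<Sum>j<n. B $$ (i, j) * exp (z j)) \<le> a * exp (z i)" if "i < n" for i and z :: "nat \<Rightarrow> real"
  proof -
    have "(\<Sum>j<n. exp (ln (B $$ (i, j)) + z j - z i)) =
        (\<Sum>j<n. B $$ (i, j) * exp (z j)) / exp (z i)"
      unfolding sum_divide_distrib using that pos
      by (intro sum.cong) (auto simp: exp_diff exp_add)
    then show ?thesis by (simp add: pos_divide_le_eq)
  qed
  have "CR RI n B \<le> \<alpha> \<longleftrightarrow>
      (\<exists>w. (\<forall>i<n. w i > 0) \<and> (\<forall>i<n. (\<Sum>j<n. B $$ (i, j) * w j) \<le> a * w i))"
    unfolding CR_le_iff[of n RI, OF \<open>n > 1\<close> \<open>RI n > 0\<close>] a_def
    using \<open>n > 1\<close> by (intro lambda_max_le_iff[OF carrier _ pos]) auto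
  also have "\<dots> \<longleftrightarrow> (\<exists>z :: nat \<Rightarrow> real. \<forall>i<n. (\<Sum>j<n. B $$ (i, j) * exp (z j)) \<le> a * exp (z i))"
    (is "?L \<longleftrightarrow> ?R")
  proof
    assume ?L
    then obtain w where w: "\<forall>i<n. w i > 0" "\<forall>i<n. (\<Sum>j<n. B $$ (i, j) * w j) \<le> a * w i"
      by blast
    then have "(\<Sum>j<n. B $$ (i, j) * exp (ln (w j))) \<le> a * exp (ln (w i))" if "i < n" for i
      using that by simp
    then show ?R by (intro exI[of _ "\<lambda>i. ln (w i)"]) blast
  next
    assume ?R
    then obtain z where "\<forall>i<n. (\<Sum>j<n. B $$ (i, j) * exp (z j)) \<le> a * exp (z i)" by blast
    then show ?L by (intro exI[of _ "\<lambda>i. exp (z i)"]) simp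
  qed
  also have "\<dots> \<longleftrightarrow> (\<exists>z. \<forall>i<n. (\<Sum>j<n. exp (ln (B $$ (i, j)) + z j - z i)) \<le> a)"
    using row by simp
  finally show ?thesis unfolding a_def .
qed

text \<open>All entries are \<open>1\<close>, so \<open>z = 0\<close> makes every row sum \<open>n\<close>, which is at most
  \<open>alpha_star RI n \<alpha>\<close>.\<close>

lemma ones_acceptable:
  assumes "n > 1" "RI n > 0" "\<alpha> \<ge> 0" "M \<ge> 1"
  shows "acceptable RI n M \<alpha> (mat n n (\<lambda>_. 1))"
proof -
  have "mat n n (\<lambda>_. 1 :: real) \<in> pairwise_comparison_mats n"
    by (auto simp: pairwise_comparison_mats_def)
  moreover from this have "CR RI n (mat n n (\<lambda>_. 1)) \<le> \<alpha>"
    using assms by (subst CR_le_iff_exp) (auto simp: alpha_star_def intro!: exI[of _ "\<lambda>_. 0"])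
  ultimately show ?thesis
    using assms(4) by (auto simp: acceptable_def bounded_mats_def)
qed

lemma upper_dist_eq_sum:
  "real (upper_dist n A B) = (\<Sum>i<n. \<Sum>j\<in>{i<..<n}. if A $$ (i, j) \<noteq> B $$ (i, j) then 1 else 0)"
proof -
  define S where "S = (SIGMA i:{..<n}. {i<..<n})"
  have fin: "finite S" by (simp add: S_def)
  have "{(i, j). i < j \<and> j < n \<and> A $$ (i, j) \<noteq> B $$ (i, j)} =
      {p \<in> S. A $$ p \<noteq> B $$ p}"
    by (auto simp: S_def)
  then have "real (upper_dist n A B) = (\<Sum>p\<in>S. if A $$ p \<noteq> B $$ p then 1 else 0)"
    unfolding upper_dist_def using fin by (simp add: sum.If_cases Int_def)
  also have "\<dots> = (\<Sum>i<n. \<Sum>j\<in>{i<..<n}. if A $$ (i, j) \<noteq> B $$ (i, j) then 1 else 0)"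
    unfolding S_def by (subst sum.Sigma) (auto simp: case_prod_unfold)
  finally show ?thesis .
qed

lemma abs_ln_le:
  fixes M t :: real
  assumes "M \<ge> 1" "t \<in> {1 / M..M}"
  shows "\<bar>ln t\<bar> \<le> ln M"
proof -
  have "t > 0" using assms by (auto intro: less_le_trans[of 0 "1 / M"])
  moreover have "ln (1 / M) \<le> ln t" "ln t \<le> ln M"
    using assms \<open>t > 0\<close> by auto
  ultimately show ?thesis using assms by (simp add: ln_div abs_le_iff)
qed

text \<open>The logarithms of the entries of \<open>B\<close> serve as \<open>x\<close>, those of a subinvariant vector as
  \<open>z\<close>, and \<open>y\<close> marks exactly the modified entries. Where \<open>y = 1\<close>, the big-M constraint
  holds because the logarithms of both entries have absolute value at most \<open>ln M\<close>.\<close>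

lemma acceptable_imp_feasible:
  assumes "n > 1" "M \<ge> 1" "RI n > 0"
    and A: "A \<in> bounded_mats n M"
    and B: "acceptable RI n M \<alpha> B"
  shows "\<exists>p. feasible n M A (alpha_star RI n \<alpha>) p \<and> objective n p = real (upper_dist n A B)"
proof -
  define x where "x = (\<lambda>i j. ln (B $$ (i, j)))"
  define y :: "nat \<Rightarrow> nat \<Rightarrow> real"
    where "y = (\<lambda>i j. if A $$ (i, j) \<noteq> B $$ (i, j) then 1 else 0)"
  have pcm: "B \<in> pairwise_comparison_mats n" and bnd: "B \<in> bounded_mats n M"
    and "CR RI n B \<le> \<alpha>"
    using B by (auto simp: acceptable_def)
  then obtain z where z: "\<forall>i<n. (\<Sum>j<n. exp (x i j + z j - z i)) \<le> alpha_star RI n \<alpha>"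
    using CR_le_iff_exp[of n RI, OF \<open>n > 1\<close> \<open>RI n > 0\<close> pcm] by (auto simp: x_def)
  have skew: "x i j = - x j i" if "j < n" "i \<le> j" for i j
  proof -
    have "B $$ (i, j) = 1 / B $$ (j, i)" "B $$ (j, i) > 0"
      using pairwise_comparison_matsD[OF pcm] that by (meson le_less_trans)+
    then show ?thesis by (simp add: x_def ln_div)
  qed
  have xb: "\<bar>x i j\<bar> \<le> ln M" and ab: "\<bar>ln (A $$ (i, j))\<bar> \<le> ln M" if "j < n" "i < j" for i j
    unfolding x_def using A bnd that
    by (auto intro!: abs_ln_le[OF \<open>M \<ge> 1\<close>] simp: bounded_mats_def)
  have bigM: "- 2 * ln M * y i j \<le> x i j - ln (A $$ (i, j)) \<and>
      x i j - ln (A $$ (i, j)) \<le> 2 * ln M * y i j" if "j < n" "i < j" for i j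
    using xb[OF that] ab[OF that] by (auto simp: y_def x_def abs_le_iff)
  have "feasible n M A (alpha_star RI n \<alpha>) (x, z, y)"
    unfolding feasible_def prod.case
  proof (intro conjI[OF z] conjI allI impI)
    fix i j assume "j < n" "i \<le> j"
    then show "x i j = - x j i" by (rule skew)
  next
    fix i j assume ij: "j < n" "i < j"
    show "- ln M \<le> x i j" "x i j \<le> ln M" using xb[OF ij] by linarith+
    show "- 2 * ln M * y i j \<le> x i j - ln (A $$ (i, j))"
      "x i j - ln (A $$ (i, j)) \<le> 2 * ln M * y i j" using bigM[OF ij] by blast+
    show "y i j \<in> {0, 1}" by (simp add: y_def)
  qed
  moreover have "objective n (x, z, y) = real (upper_dist n A B)"
    by (simp add: objective_def upper_dist_eq_sum y_def)
  ultimately show ?thesis by blast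
qed

text \<open>The matrix \<open>exp x\<close> is acceptable. The objective may exceed its distance to \<open>A\<close>, since
  \<open>y = 1\<close> is also permitted where no entry is modified; this is why only an inequality
  holds.\<close>

lemma feasible_imp_acceptable:
  assumes "n > 1" "M \<ge> 1" "RI n > 0"
    and A: "A \<in> pairwise_comparison_mats n"
    and p: "feasible n M A (alpha_star RI n \<alpha>) p"
  shows "\<exists>B. acceptable RI n M \<alpha> B \<and> real (upper_dist n A B) \<le> objective n p"
proof -
  obtain x z y where p_eq: "p = (x, z, y)" by (cases p)
  note constraints = p[unfolded p_eq feasible_def prod.case]
  have rows: "\<And>i. i < n \<Longrightarrow> (\<Sum>j<n. exp (x i j + z j - z i)) \<le> alpha_star RI n \<alpha>"
    and skew_le: "\<And>i j. j < n \<Longrightarrow> i \<le> j \<Longrightarrow> x i j = - x j i"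
    and xb_less: "\<And>i j. j < n \<Longrightarrow> i < j \<Longrightarrow> - ln M \<le> x i j \<and> x i j \<le> ln M"
    and bigM: "\<And>i j. j < n \<Longrightarrow> i < j \<Longrightarrow> - 2 * ln M * y i j \<le> x i j - ln (A $$ (i, j)) \<and>
      x i j - ln (A $$ (i, j)) \<le> 2 * ln M * y i j"
    and y01: "\<And>i j. j < n \<Longrightarrow> i < j \<Longrightarrow> y i j \<in> {0, 1}"
    using constraints by (elim conjE; metis)+
  have skew: "x i j = - x j i" if "i < n" "j < n" for i j
    using skew_le[of j i] skew_le[of i j] that by (cases "i \<le> j") linarith+
  \<comment> \<open>The bounds are imposed above the diagonal only; skew symmetry gives the rest.\<close>
  have xb: "- ln M \<le> x i j \<and> x i j \<le> ln M" if "i < n" "j < n" for i j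
  proof (cases i j rule: linorder_cases)
    case equal
    have "x i i = 0" using skew[OF that(1) that(1)] by linarith
    then show ?thesis using equal \<open>M \<ge> 1\<close> by simp
  next
    case greater
    then show ?thesis using xb_less[OF that(1) greater] skew[OF that] by linarith
  next
    case less
    then show ?thesis using xb_less[OF that(2)] by blast
  qed
  define B where "B = mat n n (\<lambda>(i, j). exp (x i j))"
  have B_nth: "B $$ (i, j) = exp (x i j)" if "i < n" "j < n" for i j
    using that by (simp add: B_def)
  have pcm: "B \<in> pairwise_comparison_mats n"
  proof -
    have "B $$ (i, j) > 0 \<and> B $$ (i, j) = 1 / B $$ (j, i)" if "i < n" "j < n" for i j
      unfolding B_nth[OF that] B_nth[OF that(2,1)] skew[OF that]
      by (simp add: exp_minus inverse_eq_divide)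
    moreover have "B \<in> carrier_mat n n" by (simp add: B_def)
    ultimately show ?thesis unfolding pairwise_comparison_mats_def by blast
  qed
  have bnd: "B \<in> bounded_mats n M"
  proof -
    have "1 / M \<le> exp (x i j) \<and> exp (x i j) \<le> M" if "i < n" "j < n" for i j
    proof -
      have "exp (- ln M) \<le> exp (x i j)" "exp (x i j) \<le> exp (ln M)"
        using xb[OF that] by simp_all
      then show ?thesis using \<open>M \<ge> 1\<close> by (simp add: exp_minus inverse_eq_divide)
    qed
    then show ?thesis by (simp add: bounded_mats_def B_def)
  qed
  have "CR RI n B \<le> \<alpha>"
    unfolding CR_le_iff_exp[of n RI, OF \<open>n > 1\<close> \<open>RI n > 0\<close> pcm]
    using rows by (intro exI[of _ z]) (simp add: B_nth)
  \<comment> \<open>A modified entry forces \<open>y = 1\<close>: for \<open>y = 0\<close> the big-M constraint collapses to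
    \<open>x i j = ln (A $$ (i, j))\<close>.\<close>
  moreover have "(if A $$ (i, j) \<noteq> B $$ (i, j) then 1 else 0) \<le> y i j" if "i < j" "j < n" for i j
  proof (cases "y i j = 0")
    case True
    have "A $$ (i, j) > 0" using pairwise_comparison_matsD(2)[OF A] that by simp
    moreover have "x i j = ln (A $$ (i, j))" using bigM[of j i] True that by simp
    ultimately show ?thesis using True that by (simp add: B_nth)
  next
    case False
    then show ?thesis using y01[of j i] that by simp
  qed
  then have "real (upper_dist n A B) \<le> objective n p"
    unfolding upper_dist_eq_sum p_eq objective_def prod.case
    by (intro sum_mono) (simp only: greaterThanLessThan_iff)
  ultimately show ?thesis using pcm bnd by (auto simp: acceptable_def)
qed

section \<open>Equality of the two optimum values\<close>

theorem theorem2: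
  fixes n :: nat and M \<alpha> :: real and RI :: "nat \<Rightarrow> real" and A :: "real mat"
  assumes "n \<ge> 3"
    and "M \<ge> 1"
    and "A \<in> pairwise_comparison_mats n \<inter> bounded_mats n M"
    and "RI n > 0"
    and "\<alpha> \<ge> 0"
  shows "\<exists>p B. is_arg_min (objective n) (feasible n M A (alpha_star RI n \<alpha>)) p
             \<and> is_arg_min (upper_dist n A) (acceptable RI n M \<alpha>) B
             \<and> objective n p = real (upper_dist n A B)"
proof -
  have n: "n > 1" using \<open>n \<ge> 3\<close> by simp
  have A: "A \<in> pairwise_comparison_mats n" "A \<in> bounded_mats n M" using assms(3) by simp_all
  obtain B where B: "is_arg_min (upper_dist n A) (acceptable RI n M \<alpha>) B"
    using is_arg_min_arg_min_nat[of "acceptable RI n M \<alpha>",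
        OF ones_acceptable[of n RI, OF n assms(4,5,2)]] by (rule that)
  then have B_acc: "acceptable RI n M \<alpha> B"
    and B_min: "\<And>B'. acceptable RI n M \<alpha> B' \<Longrightarrow> upper_dist n A B \<le> upper_dist n A B'"
    unfolding is_arg_min_linorder by simp_all
  obtain p where p: "feasible n M A (alpha_star RI n \<alpha>) p"
    "objective n p = real (upper_dist n A B)"
    using acceptable_imp_feasible[of n M RI, OF n assms(2,4) A(2) B_acc] by (elim exE conjE)
  have "objective n p \<le> objective n q" if q: "feasible n M A (alpha_star RI n \<alpha>) q" for q
  proof -
    obtain B' where "acceptable RI n M \<alpha> B'" "real (upper_dist n A B') \<le> objective n q"
      using feasible_imp_acceptable[of n M RI, OF n assms(2,4) A(1) q] by (elim exE conjE)
    then show ?thesis using B_min[of B'] p(2) by linarith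
  qed
  then have "is_arg_min (objective n) (feasible n M A (alpha_star RI n \<alpha>)) p"
    unfolding is_arg_min_linorder using p(1) by simp
  with B p(2) show ?thesis by (intro exI conjI)
qed

end
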